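(* Let $\mathrm{ctrl}(x)$ be a hybrid program (the controller) and $\mathrm{plant}(u)$ a hybrid program (the plant, a differential equation driven by the control output $u$). Let $J$ be an inductive invariant for the program $(\mathrm{ctrl}(x);\mathrm{plant}(u))^*$; in particular $J\rightarrow[\mathrm{ctrl}(x);\mathrm{plant}(u)]J$ is valid. Let $\beta$ be a fallback control, i.e., a hybrid program such that for all states $\omega,\nu$ with $(\omega,\nu)\in[\![\beta]\!]$ we have $(\omega,\nu)\models\langle\mathrm{ctrl}(x)\rangle\Upsilon^+$. Let $\omega$ be a state with $\omega\models J$ and let $\mu$ be a state with a monitor violation $(\omega,\mu)\not\models\langle\mathrm{ctrl}(x)\rangle\Upsilon^+$. Let $\tilde\mu$ be a state with $(\omega,\tilde\mu)\in[\![\beta]\!]$. Then $\nu\models J$ for all states $\nu$ with $(\tilde\mu,\nu)\in[\![\mathrm{plant}(u)]\!]$.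
   Context: Differential dynamic logic (dL): states are maps $\omega$ from a set of real-valued variables to $\mathbb{R}$. Hybrid programs are built from assignments $x:=\theta$, nondeterministic assignments $x:=*$ (any real value), tests $?F$ (continue only if formula $F$ holds in the current state, otherwise abort), differential equations $\{x'=\theta\ \&\ Q\}$ (evolve along the ODE for any nonnegative duration while staying in domain $Q$), sequential composition $\alpha;\beta$, nondeterministic choice $\alpha\cup\beta$ and nondeterministic repetition $\alpha^*$ (repeat $n\ge 0$ times); each program $\alpha$ denotes a transition relation $[\![\alpha]\!]$ on states. dL formulas extend first-order real arithmetic with $[\alpha]\phi$ (true in $\omega$ iff $\phi$ is true in all $\nu$ with $(\omega,\nu)\in[\![\alpha]\!]$) and $\langle\alpha\rangle\phi$ (true in $\omega$ iff $\phi$ is true in some such $\nu$). A formula is valid if it is true in all states. $\mathrm{BV}(\alpha)$ denotes the bound variables of $\alpha$ (those it may write). A formula $J$ is an inductive invariant of $\alpha^*$ (for a safety formula $A\rightarrow[\alpha^*]S$) if $A\rightarrow J$, $J\rightarrow[\alpha]J$ and $J\rightarrow S$ are valid. For every variable $x$ there is a fresh variable $x^+$; $\Upsilon^+$ abbreviates the conjunction of $x^+=x$ over all $x\in\mathrm{BV}(\gamma)$, where $\gamma$ is the program of the modality in which $\Upsilon^+$ occurs. Transition satisfaction: for states $\omega,\nu$ and a formula $\phi$, $(\omega,\nu)\models\phi$ iff $\phi$ is true in the state that agrees with $\omega$ except that each $x^+$ has value $\nu(x)$; otherwise $(\omega,\nu)\not\models\phi$.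
   Formalization: The formal theorem additionally assumes that the fallback control β changes no variable outside BV(ctrl(x)); without this the claim is false, e.g. ctrl = (y:=0), trivial plant, J = (x=0), β = (x:=5; y:=0). *)

theory Defs
  imports Complex_Main
begin

text \<open>\<open>Post x\<close> is the variable $x^+$ associated with \<open>x\<close>.\<close>

datatype var = Id string | Post var

type_synonym state = "var \<Rightarrow> real"

datatype trm =
    Var var
  | Const real
  | Neg trm
  | Plus trm trm
  | Minus trm trm
  | Times trm trm

text \<open>
  \<open>ODE [(x1, t1), ..., (xn, tn)] Q\<close> is the differential equation system
  $x_1' = t_1, \ldots, x_n' = t_n$ with evolution domain \<open>Q\<close>.
\<close>

datatype fml =
    TT
  | Eq trm trm
  | Less trm trm
  | Leq trm trm
  | FNot fml
  | And fml fml
  | Or fml fml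
  | Imp fml fml
  | Forall var fml
  | Exists var fml
  | Box hp fml
  | Dia hp fml
and hp =
    Assign var trm
  | AssignAny var
  | Test fml
  | ODE "(var \<times> trm) list" fml
  | Seq hp hp
  | Choice hp hp
  | Loop hp

primrec trm_sem :: "trm \<Rightarrow> state \<Rightarrow> real" where
  "trm_sem (Var x) \<omega> = \<omega> x"
| "trm_sem (Const c) \<omega> = c"
| "trm_sem (Neg s) \<omega> = - trm_sem s \<omega>"
| "trm_sem (Plus s t) \<omega> = trm_sem s \<omega> + trm_sem t \<omega>"
| "trm_sem (Minus s t) \<omega> = trm_sem s \<omega> - trm_sem t \<omega>"
| "trm_sem (Times s t) \<omega> = trm_sem s \<omega> * trm_sem t \<omega>"

text \<open>
  A solution of duration \<open>r\<close> has one-sided derivatives at the endpoints of \<open>{0..r}\<close>;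
  for \<open>r = 0\<close> the derivative condition is void and only the domain constraint remains.
  Variables without a differential equation keep their initial value.
\<close>

definition ode_solution ::
  "(var \<times> trm) list \<Rightarrow> state set \<Rightarrow> real \<Rightarrow> (real \<Rightarrow> state) \<Rightarrow> bool" where
  "ode_solution eqs Q r \<phi> \<longleftrightarrow>
     (\<forall>t\<in>{0..r}.
        \<phi> t \<in> Q
        \<and> (\<forall>(x, \<theta>)\<in>set eqs.
             ((\<lambda>s. \<phi> s x) has_real_derivative trm_sem \<theta> (\<phi> t)) (at t within {0..r}))
        \<and> (\<forall>y. y \<notin> fst ` set eqs \<longrightarrow> \<phi> t y = \<phi> 0 y))"

primrec fml_sem :: "fml \<Rightarrow> state set"
  and hp_sem :: "hp \<Rightarrow> (state \<times> state) set" where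
  "fml_sem TT = UNIV"
| "fml_sem (Eq s t) = {\<omega>. trm_sem s \<omega> = trm_sem t \<omega>}"
| "fml_sem (Less s t) = {\<omega>. trm_sem s \<omega> < trm_sem t \<omega>}"
| "fml_sem (Leq s t) = {\<omega>. trm_sem s \<omega> \<le> trm_sem t \<omega>}"
| "fml_sem (FNot \<phi>) = - fml_sem \<phi>"
| "fml_sem (And \<phi> \<psi>) = fml_sem \<phi> \<inter> fml_sem \<psi>"
| "fml_sem (Or \<phi> \<psi>) = fml_sem \<phi> \<union> fml_sem \<psi>"
| "fml_sem (Imp \<phi> \<psi>) = {\<omega>. \<omega> \<in> fml_sem \<phi> \<longrightarrow> \<omega> \<in> fml_sem \<psi>}"
| "fml_sem (Forall x \<phi>) = {\<omega>. \<forall>d. \<omega>(x := d) \<in> fml_sem \<phi>}"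
| "fml_sem (Exists x \<phi>) = {\<omega>. \<exists>d. \<omega>(x := d) \<in> fml_sem \<phi>}"
| "fml_sem (Box \<alpha> \<phi>) = {\<omega>. \<forall>\<nu>. (\<omega>, \<nu>) \<in> hp_sem \<alpha> \<longrightarrow> \<nu> \<in> fml_sem \<phi>}"
| "fml_sem (Dia \<alpha> \<phi>) = {\<omega>. \<exists>\<nu>. (\<omega>, \<nu>) \<in> hp_sem \<alpha> \<and> \<nu> \<in> fml_sem \<phi>}"
| "hp_sem (Assign x \<theta>) = {(\<omega>, \<nu>). \<nu> = \<omega>(x := trm_sem \<theta> \<omega>)}"
| "hp_sem (AssignAny x) = {(\<omega>, \<nu>). \<exists>d. \<nu> = \<omega>(x := d)}"
| "hp_sem (Test \<phi>) = {(\<omega>, \<nu>). \<nu> = \<omega> \<and> \<omega> \<in> fml_sem \<phi>}"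
| "hp_sem (ODE eqs \<phi>) =
     {(\<omega>, \<nu>). \<exists>r \<ge> 0. \<exists>\<Phi>. ode_solution eqs (fml_sem \<phi>) r \<Phi> \<and> \<Phi> 0 = \<omega> \<and> \<Phi> r = \<nu>}"
| "hp_sem (Seq \<alpha> \<beta>) = hp_sem \<alpha> O hp_sem \<beta>"
| "hp_sem (Choice \<alpha> \<beta>) = hp_sem \<alpha> \<union> hp_sem \<beta>"
| "hp_sem (Loop \<alpha>) = (hp_sem \<alpha>)\<^sup>*"

abbreviation sat :: "state \<Rightarrow> fml \<Rightarrow> bool" (infix "\<Turnstile>" 50) where
  "\<omega> \<Turnstile> \<phi> \<equiv> \<omega> \<in> fml_sem \<phi>"

definition valid :: "fml \<Rightarrow> bool" where
  "valid \<phi> \<longleftrightarrow> (\<forall>\<omega>. \<omega> \<Turnstile> \<phi>)"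

primrec trm_vars :: "trm \<Rightarrow> var set" where
  "trm_vars (Var x) = {x}"
| "trm_vars (Const c) = {}"
| "trm_vars (Neg s) = trm_vars s"
| "trm_vars (Plus s t) = trm_vars s \<union> trm_vars t"
| "trm_vars (Minus s t) = trm_vars s \<union> trm_vars t"
| "trm_vars (Times s t) = trm_vars s \<union> trm_vars t"

text \<open>All variables that occur in a formula or program, free or bound.\<close>

primrec fml_vars :: "fml \<Rightarrow> var set"
  and hp_vars :: "hp \<Rightarrow> var set" where
  "fml_vars TT = {}"
| "fml_vars (Eq s t) = trm_vars s \<union> trm_vars t"
| "fml_vars (Less s t) = trm_vars s \<union> trm_vars t"
| "fml_vars (Leq s t) = trm_vars s \<union> trm_vars t"
| "fml_vars (FNot \<phi>) = fml_vars \<phi>"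
| "fml_vars (And \<phi> \<psi>) = fml_vars \<phi> \<union> fml_vars \<psi>"
| "fml_vars (Or \<phi> \<psi>) = fml_vars \<phi> \<union> fml_vars \<psi>"
| "fml_vars (Imp \<phi> \<psi>) = fml_vars \<phi> \<union> fml_vars \<psi>"
| "fml_vars (Forall x \<phi>) = insert x (fml_vars \<phi>)"
| "fml_vars (Exists x \<phi>) = insert x (fml_vars \<phi>)"
| "fml_vars (Box \<alpha> \<phi>) = hp_vars \<alpha> \<union> fml_vars \<phi>"
| "fml_vars (Dia \<alpha> \<phi>) = hp_vars \<alpha> \<union> fml_vars \<phi>"
| "hp_vars (Assign x \<theta>) = insert x (trm_vars \<theta>)"
| "hp_vars (AssignAny x) = {x}"
| "hp_vars (Test \<phi>) = fml_vars \<phi>"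
| "hp_vars (ODE eqs \<phi>) = (\<Union>(x, \<theta>)\<in>set eqs. insert x (trm_vars \<theta>)) \<union> fml_vars \<phi>"
| "hp_vars (Seq \<alpha> \<beta>) = hp_vars \<alpha> \<union> hp_vars \<beta>"
| "hp_vars (Choice \<alpha> \<beta>) = hp_vars \<alpha> \<union> hp_vars \<beta>"
| "hp_vars (Loop \<alpha>) = hp_vars \<alpha>"

text \<open>Bound variables, that is, those a program may write.\<close>

primrec BV :: "hp \<Rightarrow> var set" where
  "BV (Assign x \<theta>) = {x}"
| "BV (AssignAny x) = {x}"
| "BV (Test \<phi>) = {}"
| "BV (ODE eqs \<phi>) = fst ` set eqs"
| "BV (Seq \<alpha> \<beta>) = BV \<alpha> \<union> BV \<beta>"
| "BV (Choice \<alpha> \<beta>) = BV \<alpha> \<union> BV \<beta>"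
| "BV (Loop \<alpha>) = BV \<alpha>"

lemma finite_BV: "finite (BV \<alpha>)"
  by (induction \<alpha> rule: hp.induct[where ?P1.0 = "\<lambda>_. True"]) auto

text \<open>
  \<open>Upsilon \<gamma>\<close> is $\Upsilon^+$ for occurrences inside a modality of \<open>\<gamma>\<close>. The conjunction ranges
  over some enumeration of \<open>BV \<gamma>\<close>; \<open>sat_Upsilon\<close> shows that the choice is immaterial.
\<close>

definition Upsilon :: "hp \<Rightarrow> fml" where
  "Upsilon \<gamma> =
     foldr And (map (\<lambda>x. Eq (Var (Post x)) (Var x)) (SOME xs. set xs = BV \<gamma>)) TT"

lemma sat_Upsilon: "\<omega> \<Turnstile> Upsilon \<gamma> \<longleftrightarrow> (\<forall>x\<in>BV \<gamma>. \<omega> (Post x) = \<omega> x)"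
proof -
  have "\<omega> \<Turnstile> foldr And (map (\<lambda>x. Eq (Var (Post x)) (Var x)) xs) TT
          \<longleftrightarrow> (\<forall>x\<in>set xs. \<omega> (Post x) = \<omega> x)" for xs
    by (induction xs) auto
  moreover have "set (SOME xs. set xs = BV \<gamma>) = BV \<gamma>"
    using someI_ex[OF finite_list[OF finite_BV]] .
  ultimately show ?thesis by (simp add: Upsilon_def)
qed

definition plus_free :: "hp \<Rightarrow> bool" where
  "plus_free \<alpha> \<longleftrightarrow> (\<forall>x. Post x \<notin> hp_vars \<alpha>)"

text \<open>The state \<open>merge_state \<omega> \<nu>\<close> agrees with \<open>\<omega>\<close> except that each $x^+$ has the value of \<open>x\<close> in \<open>\<nu>\<close>.\<close>

primrec merge_state :: "state \<Rightarrow> state \<Rightarrow> state" where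
  "merge_state \<omega> \<nu> (Id n) = \<omega> (Id n)"
| "merge_state \<omega> \<nu> (Post x) = \<nu> x"

definition trans_sat :: "state \<times> state \<Rightarrow> fml \<Rightarrow> bool" (infix "\<TTurnstile>" 50) where
  "p \<TTurnstile> \<phi> \<longleftrightarrow> merge_state (fst p) (snd p) \<Turnstile> \<phi>"

text \<open>\<open>J\<close> is an inductive invariant of \<open>Loop \<alpha>\<close> for the safety formula \<open>Imp A (Box (Loop \<alpha>) S)\<close>.\<close>

definition inductive_invariant :: "fml \<Rightarrow> fml \<Rightarrow> hp \<Rightarrow> fml \<Rightarrow> bool" where
  "inductive_invariant J A \<alpha> S \<longleftrightarrow>
     valid (Imp A J) \<and> valid (Imp J (Box \<alpha> J)) \<and> valid (Imp J S)"

definition fallback :: "hp \<Rightarrow> hp \<Rightarrow> bool" where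
  "fallback \<beta> ctrl \<longleftrightarrow>
     (\<forall>\<omega> \<nu>. (\<omega>, \<nu>) \<in> hp_sem \<beta> \<longrightarrow> (\<omega>, \<nu>) \<TTurnstile> Dia ctrl (Upsilon ctrl))"

end

theory Submission
  imports Defs
begin

text \<open>
  The monitor condition provides a run of the controller from \<open>\<omega>\<close>, with the values of \<open>\<mu>'\<close> stored
  in the $x^+$, to some state that agrees with these stored values on \<open>BV ctrl\<close>. The controller
  neither reads nor writes any $x^+$, so by coincidence there is a corresponding run from \<open>\<omega>\<close>
  itself, and it ends in \<open>\<mu>'\<close> because neither the controller nor the fallback changes variables
  outside \<open>BV ctrl\<close>. Hence every fallback step is a controller step, and the invariant applies.
\<close>

definition agree :: "var set \<Rightarrow> state \<Rightarrow> state \<Rightarrow> bool" where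
  "agree V \<omega> \<omega>' \<longleftrightarrow> (\<forall>x\<in>V. \<omega> x = \<omega>' x)"

lemma agree_sym: "agree V \<omega> \<omega>' \<Longrightarrow> agree V \<omega>' \<omega>"
  by (simp add: agree_def)

lemma agree_upd: "agree V \<omega> \<omega>' \<Longrightarrow> agree V (\<omega>(x := d)) (\<omega>'(x := d))"
  by (simp add: agree_def)

lemma agree_override_on: "agree V (override_on \<omega> \<nu> V) \<nu>"
  by (simp add: agree_def override_on_def)

lemma override_on_agree: "agree V \<omega> \<omega>' \<Longrightarrow> override_on \<omega>' \<omega> V = \<omega>'"
  by (auto simp: agree_def override_on_def)

lemma override_on_upd:
  "agree V \<omega> \<omega>' \<Longrightarrow> x \<in> V \<Longrightarrow> override_on \<omega>' (\<omega>(x := d)) V = \<omega>'(x := d)"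
  by (auto simp: agree_def override_on_def)

lemma override_on_override_on: "override_on (override_on \<omega> \<kappa> V) \<nu> V = override_on \<omega> \<nu> V"
  by (auto simp: override_on_def)

lemma trm_sem_cong:
  "trm_vars \<theta> \<subseteq> V \<Longrightarrow> agree V \<omega> \<omega>' \<Longrightarrow> trm_sem \<theta> \<omega> = trm_sem \<theta> \<omega>'"
  by (induction \<theta>) (auto simp: agree_def)

lemma ode_solution_frame:
  "ode_solution eqs Q r \<Phi> \<Longrightarrow> t \<in> {0..r} \<Longrightarrow> y \<notin> fst ` set eqs \<Longrightarrow> \<Phi> t y = \<Phi> 0 y"
  unfolding ode_solution_def by blast

text \<open>A component in \<open>V\<close> is unchanged by the override, so it keeps its
  derivative, and the right-hand sides read only \<open>V\<close>. A component outside
  \<open>V\<close> has no differential equation and is frozen at its value in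
  \<open>\<omega>\<close>.\<close>

lemma ode_solution_override_on:
  assumes sol: "ode_solution eqs Q r \<Phi>"
    and vars: "(\<Union>(x, \<theta>)\<in>set eqs. insert x (trm_vars \<theta>)) \<subseteq> V"
    and Q: "\<And>\<nu>. \<nu> \<in> Q \<Longrightarrow> override_on \<omega> \<nu> V \<in> Q"
  shows "ode_solution eqs Q r (\<lambda>t. override_on \<omega> (\<Phi> t) V)"
  unfolding ode_solution_def
proof (intro ballI conjI allI impI)
  fix t assume t: "t \<in> {0..r}"
  show "override_on \<omega> (\<Phi> t) V \<in> Q"
    using sol t Q by (auto simp: ode_solution_def)
  show "override_on \<omega> (\<Phi> t) V y = override_on \<omega> (\<Phi> 0) V y" if "y \<notin> fst ` set eqs" for y
    using ode_solution_frame[OF sol t that] by (simp add: override_on_def)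
  fix p assume p: "p \<in> set eqs"
  obtain x \<theta> where [simp]: "p = (x, \<theta>)" by fastforce
  have x: "x \<in> V" and \<theta>: "trm_vars \<theta> \<subseteq> V"
    using vars p by fastforce+
  have "((\<lambda>s. \<Phi> s x) has_real_derivative trm_sem \<theta> (\<Phi> t)) (at t within {0..r})"
    using sol t p by (fastforce simp: ode_solution_def)
  moreover have "trm_sem \<theta> (override_on \<omega> (\<Phi> t) V) = trm_sem \<theta> (\<Phi> t)"
    using trm_sem_cong[OF \<theta> agree_override_on] .
  ultimately show "case p of (x, \<theta>) \<Rightarrow>
      ((\<lambda>s. override_on \<omega> (\<Phi> s) V x) has_real_derivative
        trm_sem \<theta> (override_on \<omega> (\<Phi> t) V)) (at t within {0..r})"
    using x by simp
qed

text \<open>Coincidence for formulas and programs, proved together since modalities contain programs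
  while tests and evolution domains contain formulas. Naming the end state of the transferred run,
  instead of only asserting that one exists, lets runs be glued in \<open>Seq\<close> and
  \<open>Loop\<close> and lets an ODE trajectory be transferred pointwise. The set \<open>V\<close>
  may exceed the occurring variables, so one \<open>V\<close> serves all subexpressions.\<close>

lemma fml_sem_cong:
  "fml_vars \<phi> \<subseteq> V \<Longrightarrow> agree V \<omega> \<omega>' \<Longrightarrow> \<omega> \<Turnstile> \<phi> \<longleftrightarrow> \<omega>' \<Turnstile> \<phi>"
  and hp_sem_override_on:
  "hp_vars \<alpha> \<subseteq> V \<Longrightarrow> agree V \<omega> \<omega>' \<Longrightarrow> (\<omega>, \<nu>) \<in> hp_sem \<alpha> \<Longrightarrow>
     (\<omega>', override_on \<omega>' \<nu> V) \<in> hp_sem \<alpha>"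
proof (induction \<phi> and \<alpha> arbitrary: \<omega> \<omega>' and \<omega> \<omega>' \<nu>)
  case (Forall x \<phi>)
  have "\<omega>(x := d) \<Turnstile> \<phi> \<longleftrightarrow> \<omega>'(x := d) \<Turnstile> \<phi>" for d
    using Forall.prems by (intro Forall.IH agree_upd) auto
  then show ?case by simp
next
  case (Exists x \<phi>)
  have "\<omega>(x := d) \<Turnstile> \<phi> \<longleftrightarrow> \<omega>'(x := d) \<Turnstile> \<phi>" for d
    using Exists.prems by (intro Exists.IH agree_upd) auto
  then show ?case by simp
next
  case (Box \<alpha> \<phi>)
  \<comment> \<open>One direction is enough, as agreement is symmetric. A run from
    \<open>\<omega>\<^sub>2\<close> is carried back to \<open>\<omega>\<^sub>1\<close>, and its end
    state agrees on \<open>V\<close> with that of the carried run.\<close>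
  have "\<omega>\<^sub>2 \<Turnstile> Box \<alpha> \<phi>" if "agree V \<omega>\<^sub>1 \<omega>\<^sub>2" "\<omega>\<^sub>1 \<Turnstile> Box \<alpha> \<phi>" for \<omega>\<^sub>1 \<omega>\<^sub>2
    using Box.IH(1)[OF _ agree_sym[OF that(1)]] Box.IH(2)[OF _ agree_override_on] Box.prems(1) that(2)
    by auto
  then show ?case using Box.prems(2) agree_sym by blast
next
  case (Dia \<alpha> \<phi>)
  have "\<omega>\<^sub>2 \<Turnstile> Dia \<alpha> \<phi>" if "agree V \<omega>\<^sub>1 \<omega>\<^sub>2" "\<omega>\<^sub>1 \<Turnstile> Dia \<alpha> \<phi>" for \<omega>\<^sub>1 \<omega>\<^sub>2
    using Dia.IH(1)[OF _ that(1)] Dia.IH(2)[OF _ agree_override_on] Dia.prems(1) that(2)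
    by auto
  then show ?case using Dia.prems(2) agree_sym by blast
next
  case (Assign x \<theta>)
  then have "trm_sem \<theta> \<omega> = trm_sem \<theta> \<omega>'" by (intro trm_sem_cong) auto
  with Assign.prems override_on_upd[OF Assign.prems(2)] show ?case by (simp del: fun_upd_apply)
next
  case (AssignAny x)
  with override_on_upd[OF AssignAny.prems(2)] show ?case by auto
next
  case (Test \<phi>)
  show ?case using Test.IH[OF _ Test.prems(2)] Test.prems(1,3) override_on_agree[OF Test.prems(2)]
    by auto
next
  case (ODE eqs \<phi>)
  from ODE.prems(3) obtain r \<Phi> where r: "r \<ge> 0" "\<Phi> 0 = \<omega>" "\<Phi> r = \<nu>"
    and sol: "ode_solution eqs (fml_sem \<phi>) r \<Phi>" by auto
  \<comment> \<open>The overridden trajectory stays in the evolution domain by the induction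
    hypothesis for the domain formula, since it agrees on \<open>V\<close> with the original one at
    every time.\<close>
  have "ode_solution eqs (fml_sem \<phi>) r (\<lambda>t. override_on \<omega>' (\<Phi> t) V)"
    using ODE.prems(1) ODE.IH[OF _ agree_override_on]
    by (intro ode_solution_override_on[OF sol]) auto
  moreover have "override_on \<omega>' (\<Phi> 0) V = \<omega>'"
    using ODE.prems(2) r by (simp add: override_on_agree)
  ultimately show ?case using r by auto
next
  case (Seq \<alpha> \<beta>)
  from Seq.prems(3) obtain \<kappa> where \<kappa>: "(\<omega>, \<kappa>) \<in> hp_sem \<alpha>" "(\<kappa>, \<nu>) \<in> hp_sem \<beta>" by auto
  have "(\<omega>', override_on \<omega>' \<kappa> V) \<in> hp_sem \<alpha>"
    using Seq.IH(1)[OF _ Seq.prems(2) \<kappa>(1)] Seq.prems(1) by simp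
  \<comment> \<open>The second run is transferred from \<open>\<kappa>\<close> to the overridden
    intermediate state. Its end state is a nested override that collapses, because the outer
    override replaces all of \<open>V\<close>.\<close>
  moreover have "(override_on \<omega>' \<kappa> V, override_on \<omega>' \<nu> V) \<in> hp_sem \<beta>"
    using Seq.IH(2)[OF _ agree_sym[OF agree_override_on] \<kappa>(2), of \<omega>'] Seq.prems(1)
    by (simp add: override_on_override_on)
  ultimately show ?case by auto
next
  case (Loop \<alpha>)
  from Loop.prems(3) have "(\<omega>, \<nu>) \<in> (hp_sem \<alpha>)\<^sup>*" by simp
  then have "(\<omega>', override_on \<omega>' \<nu> V) \<in> (hp_sem \<alpha>)\<^sup>*"
  proof induction
    case base
    show ?case using Loop.prems(2) by (simp add: override_on_agree)
  next
    case (step \<kappa> \<nu>)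
    have "(override_on \<omega>' \<kappa> V, override_on \<omega>' \<nu> V) \<in> hp_sem \<alpha>"
      using Loop.IH[OF _ agree_sym[OF agree_override_on] step.hyps(2), of \<omega>'] Loop.prems(1)
      by (simp add: override_on_override_on)
    with step.IH show ?case by (rule rtrancl_into_rtrancl)
  qed
  then show ?case by simp
next
  case (Eq s t)
  then have "trm_sem s \<omega> = trm_sem s \<omega>'" "trm_sem t \<omega> = trm_sem t \<omega>'"
    by (auto intro!: trm_sem_cong[where V = V])
  then show ?case by simp
next
  case (Less s t)
  then have "trm_sem s \<omega> = trm_sem s \<omega>'" "trm_sem t \<omega> = trm_sem t \<omega>'"
    by (auto intro!: trm_sem_cong[where V = V])
  then show ?case by simp
next
  case (Leq s t)
  then have "trm_sem s \<omega> = trm_sem s \<omega>'" "trm_sem t \<omega> = trm_sem t \<omega>'"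
    by (auto intro!: trm_sem_cong[where V = V])
  then show ?case by simp
next
  case (FNot \<phi>)
  show ?case using FNot.IH[OF _ FNot.prems(2)] FNot.prems(1) by simp
next
  case (And \<phi> \<psi>)
  show ?case using And.IH[OF _ And.prems(2)] And.prems(1) by simp
next
  case (Or \<phi> \<psi>)
  show ?case using Or.IH[OF _ Or.prems(2)] Or.prems(1) by simp
next
  case (Imp \<phi> \<psi>)
  show ?case using Imp.IH[OF _ Imp.prems(2)] Imp.prems(1) by simp
next
  case (Choice \<alpha> \<beta>)
  show ?case using Choice.IH[OF _ Choice.prems(2)] Choice.prems(1,3) by auto
next
  case TT
  show ?case by simp
qed

text \<open>Used below for ordinary variables and also for the fresh $x^+$, whose stored values thus
  survive a run.\<close>

lemma bound_effect:
  "(\<omega>, \<nu>) \<in> hp_sem \<alpha> \<Longrightarrow> x \<notin> BV \<alpha> \<Longrightarrow> \<nu> x = \<omega> x"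
\<comment> \<open>The predicate for formulas is trivial: tests and evolution domains restrict runs
  but write nothing.\<close>
proof (induction \<alpha> arbitrary: \<omega> \<nu> rule: hp.induct[where ?P1.0 = "\<lambda>_. True"])
  case (ODE eqs \<phi>)
  from ODE.prems(1) obtain r \<Phi> where "r \<ge> 0" "\<Phi> 0 = \<omega>" "\<Phi> r = \<nu>"
    and "ode_solution eqs (fml_sem \<phi>) r \<Phi>" by auto
  then show ?case using ode_solution_frame[of eqs _ r \<Phi> r x] ODE.prems(2) by auto
next
  case (Seq \<alpha> \<beta>)
  from Seq.prems(1) obtain \<kappa> where "(\<omega>, \<kappa>) \<in> hp_sem \<alpha>" "(\<kappa>, \<nu>) \<in> hp_sem \<beta>" by auto
  then show ?case using Seq.IH Seq.prems(2) by (metis BV.simps(5) UnCI)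
next
  case (Loop \<alpha>)
  from Loop.prems(1) have "(\<omega>, \<nu>) \<in> (hp_sem \<alpha>)\<^sup>*" by simp
  then show ?case
  proof induction
    case (step \<kappa> \<nu>)
    have "\<nu> x = \<kappa> x" using Loop.IH[OF step.hyps(2)] Loop.prems(2) by simp
    with step.IH show ?case by simp
  qed simp
qed auto

lemma BV_subset_hp_vars: "BV \<alpha> \<subseteq> hp_vars \<alpha>"
  by (induction \<alpha> rule: hp.induct[where ?P1.0 = "\<lambda>_. True"]) fastforce+

text \<open>The formula constrains \<open>\<nu>\<close> only on \<open>BV \<alpha>\<close>;
  \<open>frame\<close> fixes the remaining variables, including every $x^+$, to their values in
  \<open>\<omega>\<close>.\<close>

lemma trans_sat_imp_hp_sem:
  assumes fresh: "plus_free \<alpha>"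
    and sat: "(\<omega>, \<nu>) \<TTurnstile> Dia \<alpha> (Upsilon \<alpha>)"
    and frame: "\<And>x. x \<notin> BV \<alpha> \<Longrightarrow> \<nu> x = \<omega> x"
  shows "(\<omega>, \<nu>) \<in> hp_sem \<alpha>"
proof -
  let ?V = "hp_vars \<alpha>" and ?m = "merge_state \<omega> \<nu>"
  from sat obtain \<rho> where \<rho>: "(?m, \<rho>) \<in> hp_sem \<alpha>"
    and eq: "\<And>x. x \<in> BV \<alpha> \<Longrightarrow> \<rho> (Post x) = \<rho> x"
    by (auto simp: trans_sat_def sat_Upsilon)
  \<comment> \<open>By freshness every variable of \<open>\<alpha>\<close> is an \<open>Id\<close>,
    and there \<open>merge_state\<close> copies \<open>\<omega>\<close>.\<close>
  have m: "?m x = \<omega> x" if "x \<in> ?V" for x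
    using that fresh by (cases x) (auto simp: plus_free_def)
  then have "(\<omega>, override_on \<omega> \<rho> ?V) \<in> hp_sem \<alpha>"
    using \<rho> by (intro hp_sem_override_on[where \<omega> = ?m]) (auto simp: agree_def)
  moreover have "override_on \<omega> \<rho> ?V x = \<nu> x" for x
  proof (cases "x \<in> BV \<alpha>")
    case True
    have "Post x \<notin> BV \<alpha>"
      using fresh BV_subset_hp_vars by (auto simp: plus_free_def)
    \<comment> \<open>The run leaves $x^+$ at its initial value in \<open>?m\<close>, which is
      \<open>\<nu> x\<close> by construction.\<close>
    then have "\<rho> (Post x) = \<nu> x" using bound_effect[OF \<rho>] by simp
    then show ?thesis using True eq BV_subset_hp_vars by (auto simp: override_on_def)
  next
    case False
    \<comment> \<open>Inside \<open>?V\<close> the value is \<open>\<rho> x\<close>, unchanged from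
      \<open>?m x\<close>; outside it is \<open>\<omega> x\<close> directly. Both equal
      \<open>\<nu> x\<close> by \<open>frame\<close>.\<close>
    then show ?thesis using bound_effect[OF \<rho> False] m frame by (simp add: override_on_def)
  qed
  ultimately show ?thesis by (metis ext)
qed

theorem theorem1:
  fixes ctrl plant \<beta> :: hp and A J S :: fml and \<omega> \<mu> \<mu>' :: state
  assumes fresh: "plus_free ctrl"
    and inv: "inductive_invariant J A (Seq ctrl plant) S"
    and fallback: "fallback \<beta> ctrl"
    and frame: "\<forall>\<omega>\<^sub>0 \<nu>\<^sub>0. (\<omega>\<^sub>0, \<nu>\<^sub>0) \<in> hp_sem \<beta> \<longrightarrow> (\<forall>x. x \<notin> BV ctrl \<longrightarrow> \<nu>\<^sub>0 x = \<omega>\<^sub>0 x)"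
    and init: "\<omega> \<Turnstile> J"
    and violation: "\<not> (\<omega>, \<mu>) \<TTurnstile> Dia ctrl (Upsilon ctrl)"
    and control: "(\<omega>, \<mu>') \<in> hp_sem \<beta>"
  shows "\<forall>\<nu>. (\<mu>', \<nu>) \<in> hp_sem plant \<longrightarrow> \<nu> \<Turnstile> J"
proof -
  have "(\<omega>, \<mu>') \<in> hp_sem ctrl"
    using fresh fallback frame control
    by (intro trans_sat_imp_hp_sem) (auto simp: fallback_def)
  \<comment> \<open>A plant run from \<open>\<mu>'\<close> now completes a run of
    \<open>Seq ctrl plant\<close> that starts in \<open>\<omega>\<close>, where \<open>J\<close>
    holds.\<close>
  then show ?thesis
    using inv init by (auto simp: inductive_invariant_def valid_def)
qed

end
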